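(* Let $K$ be a finite simplicial complex, and let $\mathcal{V}$ and $\mathcal{V}'$ be multivector fields on $K$ where $\mathcal{V}'$ is an atomic coarsening of $\mathcal{V}$. Let $A\subseteq K$ be a convex and $\mathcal{V}$-compatible set, and let $V\in\mathcal{V}'$ be the unique merged multivector (the unique element of $\mathcal{V}'\setminus\mathcal{V}$). If $V\subseteq A$ or $V\cap A=\emptyset$, then $(\mathrm{cl}(A),\mathrm{mo}(A))$ is an index pair for both $\mathrm{Inv}_{\mathcal{V}}(A)$ (under $\mathcal{V}$) and $\mathrm{Inv}_{\mathcal{V}'}(A)$ (under $\mathcal{V}'$).
   Context: $K$ is a finite simplicial complex, viewed as the finite set of its (nonempty) simplices; $\leq$ is the face relation. Homology is simplicial homology with coefficients in a fixed finite field. Closure and mouth: $\mathrm{cl}(\sigma) = \{\tau \in K : \tau \leq \sigma\}$, $\mathrm{cl}(A) = \bigcup_{\sigma\in A}\mathrm{cl}(\sigma)$ for $A\subseteq K$; $A$ is closed if $A=\mathrm{cl}(A)$; $\mathrm{mo}(A) = \mathrm{cl}(A)\setminus A$. A set $A\subseteq K$ is convex if $\sigma\leq\rho\leq\tau$ with $\sigma,\tau\in A$, $\rho\in K$ implies $\rho\in A$. A multivector is a convex subset of $K$; a multivector field on $K$ is a partition of $K$ into multivectors. $[\sigma]_{\mathcal{V}}$ is the unique multivector of $\mathcal{V}$ containing $\sigma$. A multivector $V$ is critical if $H(\mathrm{cl}(V),\mathrm{mo}(V))\neq 0$. A set $A\subseteq K$ is $\mathcal{V}$-compatible if it is a union of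 multivectors of $\mathcal{V}$. Dynamics: $F_{\mathcal{V}}(\sigma)=\mathrm{cl}(\sigma)\cup[\sigma]_{\mathcal{V}}$, and $F_{\mathcal{V}}(A)=\bigcup_{\sigma\in A}F_{\mathcal{V}}(\sigma)$. A path is a map $\rho:\mathbb{Z}\cap[0,n]\to K$ with $\rho(i+1)\in F_{\mathcal{V}}(\rho(i))$ for $0\le i\le n-1$; a solution is a map $\rho:\mathbb{Z}\to K$ with $\rho(i+1)\in F_{\mathcal{V}}(\rho(i))$ for all $i\in\mathbb{Z}$. A solution $\rho$ is essential if for every $i$ with $[\rho(i)]_{\mathcal{V}}$ not critical there exist $i^-<i<i^+$ with $[\rho(i^-)]_{\mathcal{V}}\neq[\rho(i)]_{\mathcal{V}}\neq[\rho(i^+)]_{\mathcal{V}}$. Invariant sets: $\mathrm{Inv}_{\mathcal{V}}(A)$ is the set of $\sigma\in A$ for which there is an essential solution $\rho:\mathbb{Z}\to A$ (under $\mathcal{V}$) with $\rho(i)=\sigma$ for some $i$. $S$ is an invariant set under $\mathcal{V}$ if $S=\mathrm{Inv}_{\mathcal{V}}(S)$. An invariant set $S$ is an isolated invariant set under $\mathcal{V}$ if there is a closed set $N$ (an isolating set for $S$) with $F_{\mathcal{V}}(S)\subseteq N$ such that every path $\rho:\mathbb{Z}\cap[0,n]\to N$ with $\rho(0),\rho(n)\in S$ has its whole image in $S$. Index pair: for an isolated invariant set $S$ under $\mathcal{V}$ and closed sets $E\subseteq P\subseteq K$, $(P,E)$ is an index pair for $S$ (under $\mathcal{V}$) if (1)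 $F_{\mathcal{V}}(P\setminus E)\subseteq P$; (2) $F_{\mathcal{V}}(E)\cap P\subseteq E$; (3) $S=\mathrm{Inv}_{\mathcal{V}}(P\setminus E)$. Atomic coarsening: $\mathcal{V}'$ is an atomic coarsening of $\mathcal{V}$ if each multivector of $\mathcal{V}$ is contained in a multivector of $\mathcal{V}'$, $|\mathcal{V}'\setminus\mathcal{V}|=1$ and $|\mathcal{V}\setminus\mathcal{V}'|=2$ (two multivectors of $\mathcal{V}$ are merged into one, all others are unchanged). The unique element of $\mathcal{V}'\setminus\mathcal{V}$ is the merged multivector. *)

theory Defs
  imports
    "HOL-Library.Disjoint_Sets"
    "HOL-Combinatorics.Permutations"
    "HOL-Algebra.Elementary_Groups"
    "HOL-Algebra.Ring"
begin

section \<open>Simplicial complexes\<close>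

definition finite_simplicial_complex :: "'a set set \<Rightarrow> bool" where
  "finite_simplicial_complex K \<longleftrightarrow>
     finite K \<and> (\<forall>\<sigma>\<in>K. finite \<sigma> \<and> \<sigma> \<noteq> {}) \<and>
     (\<forall>\<sigma>\<in>K. \<forall>\<tau>. \<tau> \<subseteq> \<sigma> \<and> \<tau> \<noteq> {} \<longrightarrow> \<tau> \<in> K)"

definition cl :: "'a set set \<Rightarrow> 'a set set \<Rightarrow> 'a set set" where
  "cl K A = (\<Union>\<sigma>\<in>A. {\<tau>\<in>K. \<tau> \<subseteq> \<sigma>})"

definition mo :: "'a set set \<Rightarrow> 'a set set \<Rightarrow> 'a set set" where
  "mo K A = cl K A - A"

definition closed_in_complex :: "'a set set \<Rightarrow> 'a set set \<Rightarrow> bool" where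
  "closed_in_complex K A \<longleftrightarrow> A \<subseteq> K \<and> A = cl K A"

definition convex_in_complex :: "'a set set \<Rightarrow> 'a set set \<Rightarrow> bool" where
  "convex_in_complex K A \<longleftrightarrow>
     A \<subseteq> K \<and> (\<forall>\<sigma>\<in>A. \<forall>\<tau>\<in>A. \<forall>\<rho>\<in>K. \<sigma> \<subseteq> \<rho> \<and> \<rho> \<subseteq> \<tau> \<longrightarrow> \<rho> \<in> A)"

section \<open>Relative simplicial homology\<close>

text \<open>
  Chains are the usual alternating functions on oriented simplices, so that no ordering of the
  vertices has to be chosen. An oriented \<open>n\<close>-simplex is given by a list of its \<open>n + 1\<close> distinct
  vertices, and a chain changes sign under odd permutations of that list. Chains are \<open>\<zero>\<close>
  on all lists that do not represent an \<open>n\<close>-simplex of the complex \<open>L\<close>.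
\<close>

definition ordered_simplices :: "nat \<Rightarrow> 'a set set \<Rightarrow> 'a list set" where
  "ordered_simplices n L = {xs. distinct xs \<and> length xs = n + 1 \<and> set xs \<in> L}"

definition simplicial_chains ::
    "('f, 'm) ring_scheme \<Rightarrow> nat \<Rightarrow> 'a set set \<Rightarrow> ('a list \<Rightarrow> 'f) set" where
  "simplicial_chains R n L =
     {c. (\<forall>xs\<in>ordered_simplices n L. c xs \<in> carrier R) \<and>
         (\<forall>xs. xs \<notin> ordered_simplices n L \<longrightarrow> c xs = \<zero>\<^bsub>R\<^esub>) \<and>
         (\<forall>xs\<in>ordered_simplices n L. \<forall>p. p permutes {..<length xs} \<longrightarrow>
            c (permute_list p xs) = (if evenperm p then c xs else \<ominus>\<^bsub>R\<^esub> c xs))}"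

definition simplicial_chain_group ::
    "('f, 'm) ring_scheme \<Rightarrow> nat \<Rightarrow> 'a set set \<Rightarrow> ('a list \<Rightarrow> 'f) monoid" where
  "simplicial_chain_group R n L =
     \<lparr>carrier = simplicial_chains R n L,
      mult = (\<lambda>c d xs. c xs \<oplus>\<^bsub>R\<^esub> d xs),
      one = (\<lambda>xs. \<zero>\<^bsub>R\<^esub>)\<rparr>"

text \<open>
  The coefficient of \<open>[y\<^sub>0, \<dots>, y\<^sub>k]\<close> in \<open>\<partial>[v, y\<^sub>0, \<dots>, y\<^sub>k]\<close> is \<open>+1\<close>. The value at the empty list
  would be the augmentation; it is set to \<open>\<zero>\<close>, since homology is not reduced.
\<close>

definition simplicial_boundary ::
    "('f, 'm) ring_scheme \<Rightarrow> 'a set set \<Rightarrow> ('a list \<Rightarrow> 'f) \<Rightarrow> 'a list \<Rightarrow> 'f" where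
  "simplicial_boundary R L c ys =
     (if ys = [] then \<zero>\<^bsub>R\<^esub> else \<Oplus>\<^bsub>R\<^esub>v\<in>\<Union>L. c (v # ys))"

text \<open>For \<open>n = 0\<close> the boundary is the zero function, so the truncation in \<open>n - 1\<close> is harmless.\<close>

definition simplicial_relcycles ::
    "('f, 'm) ring_scheme \<Rightarrow> nat \<Rightarrow> 'a set set \<Rightarrow> 'a set set \<Rightarrow> ('a list \<Rightarrow> 'f) set" where
  "simplicial_relcycles R n L L0 =
     {c \<in> simplicial_chains R n L. simplicial_boundary R L c \<in> simplicial_chains R (n - 1) L0}"

definition simplicial_relboundaries ::
    "('f, 'm) ring_scheme \<Rightarrow> nat \<Rightarrow> 'a set set \<Rightarrow> 'a set set \<Rightarrow> ('a list \<Rightarrow> 'f) set" where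
  "simplicial_relboundaries R n L L0 =
     {(\<lambda>xs. simplicial_boundary R L d xs \<oplus>\<^bsub>R\<^esub> e xs) | d e.
        d \<in> simplicial_chains R (n + 1) L \<and> e \<in> simplicial_chains R n L0}"

definition simplicial_relhomology ::
    "('f, 'm) ring_scheme \<Rightarrow> nat \<Rightarrow> 'a set set \<Rightarrow> 'a set set \<Rightarrow> ('a list \<Rightarrow> 'f) set monoid" where
  "simplicial_relhomology R n L L0 =
     (simplicial_chain_group R n L)\<lparr>carrier := simplicial_relcycles R n L L0\<rparr>
       Mod simplicial_relboundaries R n L L0"

section \<open>Multivector fields and their dynamics\<close>

definition multivector_field :: "'a set set \<Rightarrow> 'a set set set \<Rightarrow> bool" where
  "multivector_field K \<V> \<longleftrightarrow> partition_on K \<V> \<and> (\<forall>V\<in>\<V>. convex_in_complex K V)"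

definition multivector_of :: "'a set set set \<Rightarrow> 'a set \<Rightarrow> 'a set set" where
  "multivector_of \<V> \<sigma> = (THE V. V \<in> \<V> \<and> \<sigma> \<in> V)"

definition critical :: "'a set set \<Rightarrow> ('f, 'm) ring_scheme \<Rightarrow> 'a set set \<Rightarrow> bool" where
  "critical K R V \<longleftrightarrow> (\<exists>n. \<not> trivial_group (simplicial_relhomology R n (cl K V) (mo K V)))"

definition compatible :: "'a set set set \<Rightarrow> 'a set set \<Rightarrow> bool" where
  "compatible \<V> A \<longleftrightarrow> (\<exists>\<U>\<subseteq>\<V>. A = \<Union>\<U>)"

definition mvf_map :: "'a set set \<Rightarrow> 'a set set set \<Rightarrow> 'a set \<Rightarrow> 'a set set" where
  "mvf_map K \<V> \<sigma> = cl K {\<sigma>} \<union> multivector_of \<V> \<sigma>"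

definition mvf_image :: "'a set set \<Rightarrow> 'a set set set \<Rightarrow> 'a set set \<Rightarrow> 'a set set" where
  "mvf_image K \<V> A = (\<Union>\<sigma>\<in>A. mvf_map K \<V> \<sigma>)"

text \<open>Only the values of \<open>\<rho>\<close> on \<open>{0..n}\<close> are relevant for a path.\<close>

definition is_path ::
    "'a set set \<Rightarrow> 'a set set set \<Rightarrow> nat \<Rightarrow> (nat \<Rightarrow> 'a set) \<Rightarrow> bool" where
  "is_path K \<V> n \<rho> \<longleftrightarrow> (\<forall>i\<le>n. \<rho> i \<in> K) \<and> (\<forall>i<n. \<rho> (i + 1) \<in> mvf_map K \<V> (\<rho> i))"

definition is_solution :: "'a set set \<Rightarrow> 'a set set set \<Rightarrow> (int \<Rightarrow> 'a set) \<Rightarrow> bool" where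
  "is_solution K \<V> \<rho> \<longleftrightarrow> (\<forall>i. \<rho> i \<in> K) \<and> (\<forall>i. \<rho> (i + 1) \<in> mvf_map K \<V> (\<rho> i))"

definition essential_solution ::
    "'a set set \<Rightarrow> ('f, 'm) ring_scheme \<Rightarrow> 'a set set set \<Rightarrow> (int \<Rightarrow> 'a set) \<Rightarrow> bool" where
  "essential_solution K R \<V> \<rho> \<longleftrightarrow>
     is_solution K \<V> \<rho> \<and>
     (\<forall>i. \<not> critical K R (multivector_of \<V> (\<rho> i)) \<longrightarrow>
        (\<exists>j k. j < i \<and> i < k \<and>
           multivector_of \<V> (\<rho> j) \<noteq> multivector_of \<V> (\<rho> i) \<and>
           multivector_of \<V> (\<rho> i) \<noteq> multivector_of \<V> (\<rho> k)))"

definition Inv ::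
    "'a set set \<Rightarrow> ('f, 'm) ring_scheme \<Rightarrow> 'a set set set \<Rightarrow> 'a set set \<Rightarrow> 'a set set" where
  "Inv K R \<V> A =
     {\<sigma>\<in>A. \<exists>\<rho>. essential_solution K R \<V> \<rho> \<and> range \<rho> \<subseteq> A \<and> (\<exists>i. \<rho> i = \<sigma>)}"

definition invariant_set ::
    "'a set set \<Rightarrow> ('f, 'm) ring_scheme \<Rightarrow> 'a set set set \<Rightarrow> 'a set set \<Rightarrow> bool" where
  "invariant_set K R \<V> S \<longleftrightarrow> S = Inv K R \<V> S"

definition isolating_set ::
    "'a set set \<Rightarrow> 'a set set set \<Rightarrow> 'a set set \<Rightarrow> 'a set set \<Rightarrow> bool" where
  "isolating_set K \<V> S N \<longleftrightarrow>
     closed_in_complex K N \<and> mvf_image K \<V> S \<subseteq> N \<and>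
     (\<forall>n \<rho>. is_path K \<V> n \<rho> \<and> (\<forall>i\<le>n. \<rho> i \<in> N) \<and> \<rho> 0 \<in> S \<and> \<rho> n \<in> S
        \<longrightarrow> (\<forall>i\<le>n. \<rho> i \<in> S))"

definition isolated_invariant_set ::
    "'a set set \<Rightarrow> ('f, 'm) ring_scheme \<Rightarrow> 'a set set set \<Rightarrow> 'a set set \<Rightarrow> bool" where
  "isolated_invariant_set K R \<V> S \<longleftrightarrow>
     invariant_set K R \<V> S \<and> (\<exists>N. isolating_set K \<V> S N)"

text \<open>Index pairs are only defined for isolated invariant sets, hence the first conjunct.\<close>

definition index_pair ::
    "'a set set \<Rightarrow> ('f, 'm) ring_scheme \<Rightarrow> 'a set set set \<Rightarrow> 'a set set \<Rightarrow>
     'a set set \<times> 'a set set \<Rightarrow> bool" where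
  "index_pair K R \<V> S = (\<lambda>(P, E).
     isolated_invariant_set K R \<V> S \<and>
     closed_in_complex K P \<and> closed_in_complex K E \<and> E \<subseteq> P \<and>
     mvf_image K \<V> (P - E) \<subseteq> P \<and>
     mvf_image K \<V> E \<inter> P \<subseteq> E \<and>
     S = Inv K R \<V> (P - E))"

definition atomic_coarsening :: "'a set set set \<Rightarrow> 'a set set set \<Rightarrow> bool" where
  "atomic_coarsening \<V>' \<V> \<longleftrightarrow>
     (\<forall>U\<in>\<V>. \<exists>W\<in>\<V>'. U \<subseteq> W) \<and> card (\<V>' - \<V>) = 1 \<and> card (\<V> - \<V>') = 2"

end

theory Submission
  imports Defs
begin

text \<open>
  Homology plays no role: criticality only enters as some predicate on multivectors. The hypothesis
  on the merged multivector makes \<open>A\<close> compatible with both fields, and for a convex compatible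
  \<open>A\<close> the set \<open>cl A\<close> isolates the invariant part of \<open>A\<close>: the dynamics cannot return from
  \<open>mo A\<close> to \<open>A\<close> inside \<open>cl A\<close>, and a path in \<open>A\<close> between two points of the invariant part can
  be spliced between halves of essential solutions through its end points.
\<close>

section \<open>Multivectors and compatible sets\<close>

lemma multivector_of_eq:
  assumes "partition_on K \<V>" "W \<in> \<V>" "\<sigma> \<in> W"
  shows "multivector_of \<V> \<sigma> = W"
  unfolding multivector_of_def
  using assms by (intro the_equality) (auto simp: partition_on_def disjoint_def)

lemma multivector_of_mem:
  assumes "partition_on K \<V>" "\<sigma> \<in> K"
  shows "multivector_of \<V> \<sigma> \<in> \<V>" "\<sigma> \<in> multivector_of \<V> \<sigma>"
proof -
  obtain W where "W \<in> \<V>" "\<sigma> \<in> W"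
    using assms by (auto simp: partition_on_def)
  with multivector_of_eq[OF assms(1)] show "multivector_of \<V> \<sigma> \<in> \<V>" "\<sigma> \<in> multivector_of \<V> \<sigma>"
    by auto
qed

lemma compatible_iff:
  assumes "partition_on K \<V>" "A \<subseteq> K"
  shows "compatible \<V> A \<longleftrightarrow> (\<forall>W\<in>\<V>. W \<subseteq> A \<or> W \<inter> A = {})"
proof
  assume "compatible \<V> A"
  then obtain \<U> where U: "\<U> \<subseteq> \<V>" "A = \<Union>\<U>"
    by (auto simp: compatible_def)
  show "\<forall>W\<in>\<V>. W \<subseteq> A \<or> W \<inter> A = {}"
  proof
    fix W assume W: "W \<in> \<V>"
    show "W \<subseteq> A \<or> W \<inter> A = {}"
    proof (cases "W \<in> \<U>")
      case False
      with U W have "\<forall>U\<in>\<U>. W \<inter> U = {}"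
        using assms(1) by (metis partition_on_def disjointD subsetD)
      with U show ?thesis by blast
    qed (use U in blast)
  qed
next
  assume *: "\<forall>W\<in>\<V>. W \<subseteq> A \<or> W \<inter> A = {}"
  have "A \<subseteq> \<Union>\<V>"
    using assms by (simp add: partition_on_def)
  with * have "A = \<Union>{W\<in>\<V>. W \<subseteq> A}" by blast
  then show "compatible \<V> A"
    unfolding compatible_def by (intro exI[of _ "{W\<in>\<V>. W \<subseteq> A}"]) simp
qed

lemma multivector_of_subset_compatible:
  assumes "partition_on K \<V>" "A \<subseteq> K" "compatible \<V> A" "\<sigma> \<in> A"
  shows "multivector_of \<V> \<sigma> \<subseteq> A"
proof -
  have "\<sigma> \<in> K" using assms by blast
  with multivector_of_mem[OF assms(1)] have "multivector_of \<V> \<sigma> \<in> \<V>" "\<sigma> \<in> multivector_of \<V> \<sigma>"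
    by auto
  with assms(3,4) compatible_iff[OF assms(1,2)] show ?thesis by auto
qed

lemma multivector_of_disjoint_compatible:
  assumes "partition_on K \<V>" "A \<subseteq> K" "compatible \<V> A" "\<sigma> \<in> K - A"
  shows "multivector_of \<V> \<sigma> \<inter> A = {}"
proof -
  have "multivector_of \<V> \<sigma> \<in> \<V>" "\<sigma> \<in> multivector_of \<V> \<sigma>"
    using multivector_of_mem[OF assms(1)] assms(4) by auto
  with assms(3,4) compatible_iff[OF assms(1,2)] show ?thesis by auto
qed

section \<open>Closure and mouth of a convex set\<close>

lemma subset_cl: "A \<subseteq> K \<Longrightarrow> A \<subseteq> cl K A"
  by (auto simp: cl_def)

lemma closed_cl: "closed_in_complex K (cl K A)"
  by (auto simp: closed_in_complex_def cl_def)

text \<open>If a face of some \<sigma> in the mouth lay in \<open>A\<close>, then \<sigma> would sit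
  between two elements of \<open>A\<close>, and convexity would put \<sigma> itself into
  \<open>A\<close>.\<close>

lemma closed_mo:
  assumes "convex_in_complex K A"
  shows "closed_in_complex K (mo K A)"
proof -
  have "\<tau> \<in> mo K A" if \<sigma>: "\<sigma> \<in> mo K A" and \<tau>: "\<tau> \<in> K" "\<tau> \<subseteq> \<sigma>" for \<sigma> \<tau>
  proof -
    from \<sigma> obtain \<omega> where \<omega>: "\<omega> \<in> A" "\<sigma> \<subseteq> \<omega>" "\<sigma> \<in> K" "\<sigma> \<notin> A"
      by (auto simp: mo_def cl_def)
    have "\<tau> \<notin> A"
    proof
      assume "\<tau> \<in> A"
      with \<omega> \<tau> assms have "\<sigma> \<in> A"
        unfolding convex_in_complex_def by metis
      with \<omega> show False by simp
    qed
    moreover have "\<tau> \<subseteq> \<omega>" using \<omega> \<tau> by order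
    ultimately show ?thesis
      using \<omega> \<tau> by (auto simp: mo_def cl_def)
  qed
  moreover have "mo K A \<subseteq> K" by (auto simp: mo_def cl_def)
  ultimately show ?thesis
    by (auto simp: closed_in_complex_def cl_def)
qed

lemma cl_diff_mo: "A \<subseteq> K \<Longrightarrow> cl K A - mo K A = A"
  using subset_cl[of A K] by (auto simp: mo_def)

section \<open>The dynamics on closure and mouth\<close>

lemma mvf_image_compatible:
  assumes "partition_on K \<V>" "A \<subseteq> K" "compatible \<V> A"
  shows "mvf_image K \<V> A \<subseteq> cl K A"
proof -
  have "mvf_map K \<V> \<sigma> \<subseteq> cl K A" if "\<sigma> \<in> A" for \<sigma>
  proof -
    have "cl K {\<sigma>} \<subseteq> cl K A"
      using that by (auto simp: cl_def)
    with multivector_of_subset_compatible[OF assms that] subset_cl[OF assms(2)] show ?thesis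
      by (auto simp: mvf_map_def)
  qed
  then show ?thesis by (auto simp: mvf_image_def)
qed

text \<open>Faces of \<sigma> remain in the mouth because it is closed; the multivector of \<sigma>
  avoids \<open>A\<close> by compatibility, so its part inside \<open>cl K A\<close> is in the mouth
  too.\<close>

lemma mvf_image_mo:
  assumes "partition_on K \<V>" "convex_in_complex K A" "compatible \<V> A"
  shows "mvf_image K \<V> (mo K A) \<inter> cl K A \<subseteq> mo K A"
proof -
  have AK: "A \<subseteq> K" using assms(2) by (simp add: convex_in_complex_def)
  have "mvf_map K \<V> \<sigma> \<inter> cl K A \<subseteq> mo K A" if \<sigma>: "\<sigma> \<in> mo K A" for \<sigma>
  proof -
    have "cl K {\<sigma>} \<subseteq> mo K A"
    proof -
      have "cl K {\<sigma>} \<subseteq> cl K (mo K A)"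
        using \<sigma> by (auto simp: cl_def)
      with closed_mo[OF assms(2)] show ?thesis
        by (simp add: closed_in_complex_def)
    qed
    moreover have "multivector_of \<V> \<sigma> \<inter> A = {}"
      using multivector_of_disjoint_compatible[OF assms(1) AK assms(3)] \<sigma>
      by (auto simp: mo_def cl_def)
    ultimately show ?thesis
      by (auto simp: mvf_map_def mo_def)
  qed
  then show ?thesis by (auto simp: mvf_image_def)
qed

section \<open>Essential solutions and invariant parts\<close>

lemma is_solution_shift:
  assumes "is_solution K \<V> \<rho>"
  shows "is_solution K \<V> (\<lambda>i. \<rho> (i + a))"
proof -
  have "\<rho> (i + a + 1) \<in> mvf_map K \<V> (\<rho> (i + a))" for i
    using assms unfolding is_solution_def by blast
  moreover have "i + 1 + a = i + a + 1" for i by simp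
  ultimately show ?thesis
    using assms unfolding is_solution_def by presburger
qed

lemma essential_solution_shift:
  assumes "essential_solution K R \<V> \<rho>"
  shows "essential_solution K R \<V> (\<lambda>i. \<rho> (i + a))"
  unfolding essential_solution_def
proof (intro conjI allI impI)
  show "is_solution K \<V> (\<lambda>i. \<rho> (i + a))"
    using assms by (simp add: essential_solution_def is_solution_shift)
next
  fix i assume "\<not> critical K R (multivector_of \<V> (\<rho> (i + a)))"
  then obtain j k where "j < i + a" "i + a < k"
    "multivector_of \<V> (\<rho> j) \<noteq> multivector_of \<V> (\<rho> (i + a))"
    "multivector_of \<V> (\<rho> (i + a)) \<noteq> multivector_of \<V> (\<rho> k)"
    using assms unfolding essential_solution_def by blast
  then show "\<exists>j k. j < i \<and> i < k \<and>
      multivector_of \<V> (\<rho> (j + a)) \<noteq> multivector_of \<V> (\<rho> (i + a)) \<and>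
      multivector_of \<V> (\<rho> (i + a)) \<noteq> multivector_of \<V> (\<rho> (k + a))"
    by (intro exI[of _ "j - a"] exI[of _ "k - a"]) auto
qed

text \<open>Translation in time lets the solution pass through \<sigma> at any prescribed time
  \<open>a\<close>, as is needed for gluing solutions to a path.\<close>

lemma Inv_obtain:
  assumes "\<sigma> \<in> Inv K R \<V> A"
  obtains \<rho> where "essential_solution K R \<V> \<rho>" "range \<rho> \<subseteq> A" "\<rho> a = \<sigma>"
proof -
  obtain \<rho> i where \<rho>: "essential_solution K R \<V> \<rho>" "range \<rho> \<subseteq> A" "\<rho> i = \<sigma>"
    using assms by (auto simp: Inv_def)
  show ?thesis
  proof (rule that)
    show "essential_solution K R \<V> (\<lambda>j. \<rho> (j + (i - a)))"
      using \<rho>(1) by (rule essential_solution_shift)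
  qed (use \<rho> in auto)
qed

lemma essential_solution_in_Inv:
  assumes "essential_solution K R \<V> \<rho>" "range \<rho> \<subseteq> A"
  shows "range \<rho> \<subseteq> Inv K R \<V> A"
  using assms unfolding Inv_def by blast

text \<open>An essential solution in \<open>A\<close> witnesses membership in the invariant part for
  every one of its values, so it already runs inside that part.\<close>

lemma invariant_Inv: "invariant_set K R \<V> (Inv K R \<V> A)"
proof -
  have "\<sigma> \<in> Inv K R \<V> (Inv K R \<V> A)" if \<sigma>: "\<sigma> \<in> Inv K R \<V> A" for \<sigma>
  proof -
    obtain \<rho> where \<rho>: "essential_solution K R \<V> \<rho>" "range \<rho> \<subseteq> A" "\<rho> 0 = \<sigma>"
      using Inv_obtain[OF \<sigma>, of 0] .
    have "range \<rho> \<subseteq> Inv K R \<V> A"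
      using \<rho>(1,2) by (rule essential_solution_in_Inv)
    with \<rho>(1) have "range \<rho> \<subseteq> Inv K R \<V> (Inv K R \<V> A)"
      by (rule essential_solution_in_Inv)
    with \<rho>(3) show ?thesis by auto
  qed
  moreover have "Inv K R \<V> (Inv K R \<V> A) \<subseteq> Inv K R \<V> A"
    by (auto simp: Inv_def[of _ _ _ "Inv K R \<V> A"])
  ultimately show ?thesis
    unfolding invariant_set_def by blast
qed

section \<open>Isolation by the closure\<close>

lemma path_stays_in_mo:
  assumes mvf: "partition_on K \<V>" "convex_in_complex K A" "compatible \<V> A"
    and path: "is_path K \<V> n \<rho>" "\<forall>i\<le>n. \<rho> i \<in> cl K A"
    and "\<rho> i \<in> mo K A" "i \<le> j" "j \<le> n"
  shows "\<rho> j \<in> mo K A"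
  using assms(7,8)
proof (induction j rule: dec_induct)
  case base
  show ?case using assms(6) .
next
  case (step k)
  then have "\<rho> (k + 1) \<in> mvf_image K \<V> (mo K A)"
    using path(1) unfolding is_path_def mvf_image_def
    by (auto intro!: bexI[of _ "\<rho> k"])
  moreover have "\<rho> (k + 1) \<in> cl K A"
    using path(2) step by simp
  ultimately show ?case
    using mvf_image_mo[OF mvf] by auto
qed

text \<open>If the multivector of \<open>\<theta>\<close> never changes after time \<open>i\<close>, then that of \<open>\<rho>\<^sub>2\<close> never changes
  after time \<open>max n i\<close>, contradicting essentiality of \<open>\<rho>\<^sub>2\<close>; symmetrically for the past.\<close>

lemma essential_solution_splice:
  assumes \<rho>1: "essential_solution K R \<V> \<rho>\<^sub>1" and \<rho>2: "essential_solution K R \<V> \<rho>\<^sub>2"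
    and \<theta>: "is_solution K \<V> \<theta>"
    and past: "\<And>i. i \<le> m \<Longrightarrow> \<theta> i = \<rho>\<^sub>1 i" and future: "\<And>i. n \<le> i \<Longrightarrow> \<theta> i = \<rho>\<^sub>2 i"
  shows "essential_solution K R \<V> \<theta>"
  unfolding essential_solution_def
proof (intro conjI allI impI)
  fix i
  let ?mv = "\<lambda>i. multivector_of \<V> (\<theta> i)"
  assume nc: "\<not> critical K R (?mv i)"
  have "\<exists>j<i. ?mv j \<noteq> ?mv i"
  \<comment> \<open>The time \<open>min m i\<close> is at most \<open>i\<close> and lies where
    \<theta> agrees with \<open>\<rho>\<^sub>1\<close>. Either its multivector already differs from
    that at \<open>i\<close>, or essentiality of \<open>\<rho>\<^sub>1\<close> supplies an earlier
    time where it differs.\<close>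
  proof (cases "?mv (min m i) = ?mv i")
    case True
    with nc have "\<not> critical K R (multivector_of \<V> (\<rho>\<^sub>1 (min m i)))"
      by (simp add: past)
    then obtain j where "j < min m i"
      "multivector_of \<V> (\<rho>\<^sub>1 j) \<noteq> multivector_of \<V> (\<rho>\<^sub>1 (min m i))"
      using \<rho>1 unfolding essential_solution_def by blast
    with True show ?thesis
      by (metis past min.cobounded1 min.strict_boundedE less_imp_le)
  next
    case False
    then show ?thesis by (metis min.cobounded2 order_le_less)
  qed
  moreover have "\<exists>k>i. ?mv i \<noteq> ?mv k"
  proof (cases "?mv (max n i) = ?mv i")
    case True
    with nc have "\<not> critical K R (multivector_of \<V> (\<rho>\<^sub>2 (max n i)))"
      by (simp add: future)
    then obtain k where "max n i < k"
      "multivector_of \<V> (\<rho>\<^sub>2 (max n i)) \<noteq> multivector_of \<V> (\<rho>\<^sub>2 k)"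
      using \<rho>2 unfolding essential_solution_def by blast
    with True show ?thesis
      by (metis future max.cobounded1 max.strict_boundedE less_imp_le)
  next
    case False
    then show ?thesis by (metis max.cobounded2 order_le_less)
  qed
  ultimately show "\<exists>j k. j < i \<and> i < k \<and> ?mv j \<noteq> ?mv i \<and> ?mv i \<noteq> ?mv k"
    by blast
qed (rule \<theta>)

text \<open>The past of an essential solution through \<open>\<rho> 0\<close>, the path, and the
  future of one through \<open>\<rho> n\<close> join to an essential solution in \<open>A\<close>
  that visits every point of the path.\<close>

lemma path_in_Inv:
  assumes path: "is_path K \<V> n \<rho>" "\<forall>i\<le>n. \<rho> i \<in> A"
    and ends: "\<rho> 0 \<in> Inv K R \<V> A" "\<rho> n \<in> Inv K R \<V> A"
    and "i \<le> n"
  shows "\<rho> i \<in> Inv K R \<V> A"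
proof -
  obtain \<rho>\<^sub>1 where \<rho>1: "essential_solution K R \<V> \<rho>\<^sub>1" "range \<rho>\<^sub>1 \<subseteq> A" "\<rho>\<^sub>1 0 = \<rho> 0"
    using Inv_obtain[OF ends(1), of 0] .
  obtain \<rho>\<^sub>2 where \<rho>2: "essential_solution K R \<V> \<rho>\<^sub>2" "range \<rho>\<^sub>2 \<subseteq> A" "\<rho>\<^sub>2 (int n) = \<rho> n"
    using Inv_obtain[OF ends(2), of "int n"] .
  \<comment> \<open>Neighbouring pieces agree at the seams \<open>0\<close> and
    \<open>int n\<close>, so either formula may be used there. For \<open>n = 0\<close> the middle
    branch is empty and both seams coincide.\<close>
  define \<theta> where "\<theta> k = (if k \<le> 0 then \<rho>\<^sub>1 k else if k < int n then \<rho> (nat k) else \<rho>\<^sub>2 k)" for k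
  have past: "\<theta> k = \<rho>\<^sub>1 k" if "k \<le> 0" for k
    using that by (simp add: \<theta>_def)
  have mid: "\<theta> k = \<rho> (nat k)" if "0 \<le> k" "k \<le> int n" for k
    using that \<rho>1(3) \<rho>2(3) by (auto simp: \<theta>_def)
  have sol: "is_solution K \<V> \<rho>\<^sub>1" "is_solution K \<V> \<rho>\<^sub>2"
    using \<rho>1 \<rho>2 by (auto simp: essential_solution_def)
  have future: "\<theta> k = \<rho>\<^sub>2 k" if "int n \<le> k" for k
    using that \<rho>2(3) mid[of k] by (cases "k = int n") (auto simp: \<theta>_def)
  have "is_solution K \<V> \<theta>"
    unfolding is_solution_def
  proof (intro conjI allI)
    fix k
    show "\<theta> k \<in> K"
      using sol path(1) by (auto simp: \<theta>_def is_solution_def is_path_def)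
    \<comment> \<open>In each case \<open>k\<close> and \<open>k + 1\<close> both lie in the range
      of a single piece, seams included.\<close>
    consider "k < 0" | "0 \<le> k" "k < int n" | "int n \<le> k" by linarith
    then show "\<theta> (k + 1) \<in> mvf_map K \<V> (\<theta> k)"
    proof cases
      case 1
      with sol(1) show ?thesis by (simp add: past is_solution_def)
    next
      case 2
      then have "nat (k + 1) = nat k + 1" "nat k < n" by auto
      with 2 path(1) show ?thesis by (simp add: mid is_path_def)
    next
      case 3
      with sol(2) show ?thesis by (simp add: future is_solution_def)
    qed
  qed
  with \<rho>1(1) \<rho>2(1) have "essential_solution K R \<V> \<theta>"
    by (rule essential_solution_splice[of _ _ _ _ _ _ 0 "int n"]) (auto simp: past future)
  moreover have "range \<theta> \<subseteq> A"
    using \<rho>1(2) \<rho>2(2) path(2) by (auto simp: \<theta>_def)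
  ultimately have "range \<theta> \<subseteq> Inv K R \<V> A"
    by (rule essential_solution_in_Inv)
  with mid[of "int i"] \<open>i \<le> n\<close> show ?thesis
    by (metis nat_int of_nat_0_le_iff of_nat_le_iff range_subsetD)
qed

lemma isolating_set_cl:
  assumes "partition_on K \<V>" "convex_in_complex K A" "compatible \<V> A"
  shows "isolating_set K \<V> (Inv K R \<V> A) (cl K A)"
  unfolding isolating_set_def
proof (intro conjI allI impI)
  have AK: "A \<subseteq> K" using assms(2) by (simp add: convex_in_complex_def)
  have InvA: "Inv K R \<V> A \<subseteq> A" by (auto simp: Inv_def)
  show "closed_in_complex K (cl K A)" by (rule closed_cl)
  have "mvf_image K \<V> (Inv K R \<V> A) \<subseteq> mvf_image K \<V> A"
    using InvA by (auto simp: mvf_image_def)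
  then show "mvf_image K \<V> (Inv K R \<V> A) \<subseteq> cl K A"
    using mvf_image_compatible[OF assms(1) AK assms(3)] by blast
  fix n \<rho> i
  assume *: "is_path K \<V> n \<rho> \<and> (\<forall>i\<le>n. \<rho> i \<in> cl K A) \<and>
      \<rho> 0 \<in> Inv K R \<V> A \<and> \<rho> n \<in> Inv K R \<V> A" and "i \<le> n"
  \<comment> \<open>Inside \<open>cl K A\<close>, leaving \<open>A\<close> means entering the mouth,
    which would trap the path up to its end, although \<open>\<rho> n\<close> lies in
    \<open>A\<close>.\<close>
  have "\<rho> j \<in> A" if "j \<le> n" for j
  proof (rule ccontr)
    assume "\<rho> j \<notin> A"
    with * that have "\<rho> j \<in> mo K A" by (simp add: mo_def)
    then have "\<rho> n \<in> mo K A"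
      using path_stays_in_mo[OF assms] * that by blast
    with * InvA show False by (auto simp: mo_def)
  qed
  then show "\<rho> i \<in> Inv K R \<V> A"
    using path_in_Inv[of K \<V> n \<rho> A R i] * \<open>i \<le> n\<close> by simp
qed

section \<open>The index pair and the coarsening\<close>

lemma index_pair_cl_mo:
  assumes "partition_on K \<V>" "convex_in_complex K A" "compatible \<V> A"
  shows "index_pair K R \<V> (Inv K R \<V> A) (cl K A, mo K A)"
proof -
  have AK: "A \<subseteq> K" using assms(2) by (simp add: convex_in_complex_def)
  have "isolated_invariant_set K R \<V> (Inv K R \<V> A)"
    using invariant_Inv isolating_set_cl[OF assms] unfolding isolated_invariant_set_def by blast
  moreover have "mo K A \<subseteq> cl K A" by (auto simp: mo_def)
  \<comment> \<open>As \<open>cl K A - mo K A\<close> is \<open>A\<close>, the first condition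
    concerns the image of \<open>A\<close> and the third becomes an identity.\<close>
  ultimately show ?thesis
    using closed_cl closed_mo[OF assms(2)] mvf_image_compatible[OF assms(1) AK assms(3)]
      mvf_image_mo[OF assms] by (simp add: index_pair_def cl_diff_mo[OF AK])
qed

theorem theorem13:
  fixes K :: "'a set set" and R :: "('f, 'm) ring_scheme"
    and \<V> \<V>' :: "'a set set set" and A V :: "'a set set"
  assumes "finite_simplicial_complex K"
    and "field R" and "finite (carrier R)"
    and "multivector_field K \<V>" and "multivector_field K \<V>'"
    and "atomic_coarsening \<V>' \<V>"
    and "A \<subseteq> K" and "convex_in_complex K A" and "compatible \<V> A"
    and "\<V>' - \<V> = {V}"
    and "V \<subseteq> A \<or> V \<inter> A = {}"
  shows "index_pair K R \<V> (Inv K R \<V> A) (cl K A, mo K A) \<and>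
         index_pair K R \<V>' (Inv K R \<V>' A) (cl K A, mo K A)"
proof -
  have part: "partition_on K \<V>" "partition_on K \<V>'"
    using assms(4,5) by (auto simp: multivector_field_def)
  \<comment> \<open>A multivector of \<open>\<V>'\<close> either belongs to \<open>\<V>\<close>,
    where compatibility of \<open>A\<close> applies, or is the merged \<open>V\<close>.\<close>
  have "\<forall>W\<in>\<V>'. W \<subseteq> A \<or> W \<inter> A = {}"
    using assms(9-11) compatible_iff[OF part(1) assms(7)] by blast
  then have "compatible \<V>' A"
    using compatible_iff[OF part(2) assms(7)] by blast
  with part assms(8,9) show ?thesis
    by (simp add: index_pair_cl_mo)
qed

end
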